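(* Let $(\Omega,\mathcal{F},\mathbb{P})$ be an atomless probability space and let $\mathcal{M}$ be the set of all random variables $\xi\colon\Omega\to\mathbb{R}$, where two random variables are identified if they have the same law, ordered by the usual stochastic order $\preccurlyeq_{\rm st}$. Let $\psi\colon\mathcal{M}\to(-\infty,\infty]$ be a function, and put $A_s:=\{\xi\in\mathcal{M}\colon\psi(\xi)\le s\}$, $\alpha_{\min}(s,u):=\sup_{\xi\in A_s}q_\xi(u)$ and $\alpha_{\min}^+(s,u):=\inf_{t>s}\alpha_{\min}(t,u)$ for $s\in\mathbb{R}$, $u\in(0,1)$. Then the following conditions are equivalent: (i) $\psi$ is bounded countably maxitive with respect to $\preccurlyeq_{\rm st}$. (ii) $\psi$ is monotone and has countably upwards directed sublevel sets with respect to $\preccurlyeq_{\rm st}$. (iii) There exists a function $\alpha\colon\mathbb{R}\times(0,1)\to[-\infty,\infty)$ which is non-decreasing in the first argument such that $$\psi(\xi)=\inf\Big\{s\in\mathbb{R}\colon\sup_{u\in(0,1)}\{q_\xi(u)-\alpha(s,u)\}\le 0\Big\}\quad\text{for all }\xi\in\mathcal{M},$$ and the infimum is attained for all $\xi\in\mathcal{M}$ with $\psi(\xi)<\infty$. (iv) The mapping $u\mapsto\alpha_{\min}(s,u)$ is real-valued for all $s\in\mathbb{R}$ with $A_s\ne\emptyset$, and $$\psi(\xi)=\sup_{u\in(0,1)}G(q_\xi(u),u)\quad\text{for all }\xi\in\mathcal{M},$$ where $G(t,u):=\inf\{s\in\mathbb{R}\colon t\le\alpha_{\min}^+(s,u)\}$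 for all $(t,u)\in\mathbb{R}\times(0,1)$.
   Context: A probability space is atomless if for every $A\in\mathcal{F}$ with $\mathbb{P}(A)>0$ there is $B\in\mathcal{F}$ with $B\subset A$ and $0<\mathbb{P}(B)<\mathbb{P}(A)$. For $\xi\in\mathcal{M}$, the quantile function is $q_\xi\colon(0,1)\to\mathbb{R}$, $q_\xi(u):=\inf\{v\in\mathbb{R}\colon u\le\mathbb{P}(\xi\le v)\}$. The usual stochastic order is: $\xi\preccurlyeq_{\rm st}\eta$ if and only if $q_\xi(u)\le q_\eta(u)$ for all $u\in(0,1)$. Every non-empty countable subset of $\mathcal{M}$ that is bounded from above with respect to $\preccurlyeq_{\rm st}$ has a unique supremum $\vee Y$ in $\mathcal{M}$, given by the pointwise supremum of the quantile functions. The function $\psi$ is bounded countably maxitive if for every non-empty countable $Y\subset\mathcal{M}$: $\sup_{y\in Y}\psi(y)=\psi(\vee Y)$ if $Y$ is bounded from above, and $\sup_{y\in Y}\psi(y)=\infty$ otherwise. $\psi$ is monotone if $\xi\preccurlyeq_{\rm st}\eta$ implies $\psi(\xi)\le\psi(\eta)$. $\psi$ has countably upwards directed sublevel sets if for every $s\in\mathbb{R}$ and every non-empty countable $Y\subset A_s$ there is $y^\ast\in A_s$ with $y\preccurlyeq_{\rm st}y^\ast$ for all $y\in Y$. Conventions: $\inf\emptyset=\infty$, $\sup\emptyset=-\infty$, and $r-(-\infty)=\infty$ for $r\in\mathbb{R}$. *)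

theory Defs
  imports "HOL-Probability.Probability"
begin

definition atomless :: "'a measure \<Rightarrow> bool" where
  "atomless M \<longleftrightarrow>
     (\<forall>A\<in>sets M. measure M A > 0 \<longrightarrow>
        (\<exists>B\<in>sets M. B \<subseteq> A \<and> 0 < measure M B \<and> measure M B < measure M A))"

definition same_law :: "'a measure \<Rightarrow> (('a \<Rightarrow> real) \<times> ('a \<Rightarrow> real)) set" where
  "same_law M = {(X, Y). X \<in> borel_measurable M \<and> Y \<in> borel_measurable M \<and>
                         distr M borel X = distr M borel Y}"

text \<open>Random variables up to equality in law; an element is an equivalence class.\<close>

definition rv_classes :: "'a measure \<Rightarrow> ('a \<Rightarrow> real) set set" where
  "rv_classes M = borel_measurable M // same_law M"

definition rv_quantile :: "'a measure \<Rightarrow> ('a \<Rightarrow> real) \<Rightarrow> real \<Rightarrow> real" where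
  "rv_quantile M X u = Inf {v. u \<le> measure M {\<omega>\<in>space M. X \<omega> \<le> v}}"

text \<open>The quantile function of a class is that of any of its members; this does not depend
  on the member, see \<open>quantile_class\<close> below.\<close>

definition quantile :: "'a measure \<Rightarrow> ('a \<Rightarrow> real) set \<Rightarrow> real \<Rightarrow> real" where
  "quantile M \<xi> u = the_elem ((\<lambda>X. rv_quantile M X u) ` \<xi>)"

lemma equiv_same_law: "equiv (borel_measurable M) (same_law M)"
  by (rule equivI) (auto simp: same_law_def refl_on_def sym_def trans_def)

lemma rv_quantile_same_law:
  assumes "(X, Y) \<in> same_law M"
  shows "rv_quantile M X = rv_quantile M Y"
proof -
  have *: "measure M {\<omega>\<in>space M. Z \<omega> \<le> v} = measure (distr M borel Z) {..v}"
    if "Z \<in> borel_measurable M" for Z :: "'a \<Rightarrow> real" and v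
    using that by (subst measure_distr) (auto simp: vimage_def Int_def intro!: arg_cong[where f = "measure M"])
  show ?thesis
    using assms by (auto simp: same_law_def rv_quantile_def fun_eq_iff *)
qed

lemma quantile_class:
  assumes "\<xi> \<in> rv_classes M" "X \<in> \<xi>"
  shows "quantile M \<xi> u = rv_quantile M X u"
proof -
  have "(X, Y) \<in> same_law M" if "Y \<in> \<xi>" for Y
    using assms that quotient_eq_iff[OF equiv_same_law] by (metis rv_classes_def)
  then have "(\<lambda>X. rv_quantile M X u) ` \<xi> = {rv_quantile M X u}"
    using assms(2) rv_quantile_same_law[of X _ M] by (auto simp: image_iff) metis
  then show ?thesis
    by (simp add: quantile_def)
qed

definition st_le :: "'a measure \<Rightarrow> ('a \<Rightarrow> real) set \<Rightarrow> ('a \<Rightarrow> real) set \<Rightarrow> bool" where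
  "st_le M \<xi> \<eta> \<longleftrightarrow> (\<forall>u\<in>{0<..<1}. quantile M \<xi> u \<le> quantile M \<eta> u)"

definition st_upper :: "'a measure \<Rightarrow> ('a \<Rightarrow> real) set set \<Rightarrow> ('a \<Rightarrow> real) set \<Rightarrow> bool" where
  "st_upper M Y \<eta> \<longleftrightarrow> \<eta> \<in> rv_classes M \<and> (\<forall>y\<in>Y. st_le M y \<eta>)"

text \<open>The least upper bound. On an atomless probability space it exists and is unique for
  non-empty countable sets that are bounded from above, the only ones it is applied to.\<close>

definition st_Sup :: "'a measure \<Rightarrow> ('a \<Rightarrow> real) set set \<Rightarrow> ('a \<Rightarrow> real) set" where
  "st_Sup M Y = (THE \<sigma>. st_upper M Y \<sigma> \<and> (\<forall>\<eta>. st_upper M Y \<eta> \<longrightarrow> st_le M \<sigma> \<eta>))"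

definition bounded_countably_maxitive ::
    "'a measure \<Rightarrow> (('a \<Rightarrow> real) set \<Rightarrow> ereal) \<Rightarrow> bool" where
  "bounded_countably_maxitive M \<psi> \<longleftrightarrow>
     (\<forall>Y. Y \<subseteq> rv_classes M \<and> Y \<noteq> {} \<and> countable Y \<longrightarrow>
        ((\<exists>\<eta>. st_upper M Y \<eta>) \<longrightarrow> (SUP y\<in>Y. \<psi> y) = \<psi> (st_Sup M Y)) \<and>
        (\<not> (\<exists>\<eta>. st_upper M Y \<eta>) \<longrightarrow> (SUP y\<in>Y. \<psi> y) = \<infinity>))"

definition st_monotone :: "'a measure \<Rightarrow> (('a \<Rightarrow> real) set \<Rightarrow> ereal) \<Rightarrow> bool" where
  "st_monotone M \<psi> \<longleftrightarrow>
     (\<forall>\<xi>\<in>rv_classes M. \<forall>\<eta>\<in>rv_classes M. st_le M \<xi> \<eta> \<longrightarrow> \<psi> \<xi> \<le> \<psi> \<eta>)"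

definition sublevel ::
    "'a measure \<Rightarrow> (('a \<Rightarrow> real) set \<Rightarrow> ereal) \<Rightarrow> real \<Rightarrow> ('a \<Rightarrow> real) set set" where
  "sublevel M \<psi> s = {\<xi>\<in>rv_classes M. \<psi> \<xi> \<le> ereal s}"

definition countably_directed_sublevels ::
    "'a measure \<Rightarrow> (('a \<Rightarrow> real) set \<Rightarrow> ereal) \<Rightarrow> bool" where
  "countably_directed_sublevels M \<psi> \<longleftrightarrow>
     (\<forall>s Y. Y \<subseteq> sublevel M \<psi> s \<and> Y \<noteq> {} \<and> countable Y \<longrightarrow>
        (\<exists>y'\<in>sublevel M \<psi> s. \<forall>y\<in>Y. st_le M y y'))"

definition alpha_min ::
    "'a measure \<Rightarrow> (('a \<Rightarrow> real) set \<Rightarrow> ereal) \<Rightarrow> real \<Rightarrow> real \<Rightarrow> ereal" where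
  "alpha_min M \<psi> s u = (SUP \<xi>\<in>sublevel M \<psi> s. ereal (quantile M \<xi> u))"

definition alpha_min_plus ::
    "'a measure \<Rightarrow> (('a \<Rightarrow> real) set \<Rightarrow> ereal) \<Rightarrow> real \<Rightarrow> real \<Rightarrow> ereal" where
  "alpha_min_plus M \<psi> s u = (INF t\<in>{s<..}. alpha_min M \<psi> t u)"

definition G_min ::
    "'a measure \<Rightarrow> (('a \<Rightarrow> real) set \<Rightarrow> ereal) \<Rightarrow> real \<Rightarrow> real \<Rightarrow> ereal" where
  "G_min M \<psi> t u = Inf (ereal ` {s. ereal t \<le> alpha_min_plus M \<psi> s u})"

text \<open>The levels \<open>s\<close> over which the infimum in the quantile representation is taken.\<close>

definition admissible_levels ::
    "'a measure \<Rightarrow> (real \<Rightarrow> real \<Rightarrow> ereal) \<Rightarrow> ('a \<Rightarrow> real) set \<Rightarrow> ereal set" where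
  "admissible_levels M \<alpha> \<xi> =
     ereal ` {s. (SUP u\<in>{0<..<1}. ereal (quantile M \<xi> u) - \<alpha> s u) \<le> 0}"

end

theory Submission
  imports Defs
begin

text \<open>
  By left-continuity of quantile functions, a countably directed sublevel set \<open>A\<^sub>s\<close> has a greatest
  element: an upper bound of countably many members that approximate \<open>\<alpha>\<^sub>m\<^sub>i\<^sub>n(s, u)\<close> at all rational \<open>u\<close>
  dominates \<open>A\<^sub>s\<close>, and its quantile function is \<open>\<alpha>\<^sub>m\<^sub>i\<^sub>n(s, \<cdot>)\<close>. So each condition says that
  \<open>A\<^sub>s = {\<xi>. q\<^sub>\<xi> \<le> \<beta>(s, \<cdot>)}\<close> for some \<open>\<beta>\<close>. Conversely such sets are closed under pointwise suprema
  of quantile functions, which are again quantile functions because an atomless space carries a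
  uniform random variable: along a maximal chain of events the measure takes every value in \<open>[0, 1]\<close>.
\<close>

subsection \<open>Uniform random variables on atomless spaces\<close>

text \<open>Finite unions of pairwise comparable sets are again members of the sequence, so
  continuity from below applies to the partial unions even if \<open>f\<close> itself is not
  increasing.\<close>

lemma (in finite_measure) measure_Union_chain_le:
  assumes "range f \<subseteq> sets M" "\<And>i j. f i \<subseteq> f j \<or> f j \<subseteq> f i"
    and "\<And>n::nat. measure M (f n) \<le> c"
  shows "measure M (\<Union>n. f n) \<le> c"
proof -
  define h where "h n = (\<Union>i\<le>n. f i)" for n
  have h: "h n \<in> range f" for n
  proof (induction n)
    case 0
    then show ?case by (auto simp: h_def)
  next
    case (Suc n)
    then obtain i where "h n = f i" by auto
    moreover have "h (Suc n) = h n \<union> f (Suc n)"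
      by (auto simp: h_def le_Suc_eq)
    ultimately show ?case
      using assms(2)[of i "Suc n"] by (auto simp: Un_absorb1 Un_absorb2)
  qed
  have "(\<lambda>n. measure M (h n)) \<longlonglongrightarrow> measure M (\<Union>n. h n)"
  proof (rule finite_Lim_measure_incseq)
    show "range h \<subseteq> sets M"
      using h assms(1) by blast
    show "incseq h"
      by (fastforce simp: incseq_def h_def)
  qed
  moreover have "(\<Union>n. h n) = (\<Union>n. f n)"
    by (auto simp: h_def)
  moreover have "measure M (h n) \<le> c" for n
    using h[of n] assms(3) by auto
  ultimately show ?thesis
    by (metis LIMSEQ_le_const2)
qed

text \<open>Follows from the bound for unions by passing to complements in
  \<open>space M\<close>.\<close>

lemma (in finite_measure) measure_Inter_chain_ge:
  assumes "range f \<subseteq> sets M" "\<And>i j. f i \<subseteq> f j \<or> f j \<subseteq> f i"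
    and "\<And>n::nat. c \<le> measure M (f n)"
  shows "c \<le> measure M (\<Inter>n. f n)"
proof -
  have "measure M (\<Union>n. space M - f n) \<le> measure M (space M) - c"
  proof (rule measure_Union_chain_le)
    show "space M - f i \<subseteq> space M - f j \<or> space M - f j \<subseteq> space M - f i" for i j
      using assms(2)[of i j] by auto
    have "f n \<in> sets M" for n
      using assms(1) by auto
    then show "measure M (space M - f n) \<le> measure M (space M) - c" for n
      using assms(3)[of n] by (simp add: finite_measure_compl)
  qed (use assms(1) in auto)
  moreover have "(\<Union>n. space M - f n) = space M - (\<Inter>n. f n)"
    by auto
  moreover have "(\<Inter>n. f n) \<in> sets M"
    using assms(1) by (intro sets.countable_INT) auto
  ultimately show ?thesis
    by (simp add: finite_measure_compl)
qed

text \<open>\<open>B\<close> is read off from a maximal chain. The measures attained on the chain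
  leave no gap: the end points of a gap would be attained, and atomlessness would let a set be
  inserted strictly between them.\<close>

theorem (in finite_measure) atomless_increasing_family:
  assumes "atomless M"
  obtains B :: "real \<Rightarrow> 'a set"
  where "\<And>t. t \<in> {0..measure M (space M)} \<Longrightarrow> B t \<in> sets M"
    and "\<And>t. t \<in> {0..measure M (space M)} \<Longrightarrow> measure M (B t) = t"
    and "mono_on {0..measure M (space M)} B"
proof -
  \<comment> \<open>Requiring the measure to grow strictly keeps null sets out of the chain: the gap between two
    neighbouring members is then never crossed by a further member of the same measure.\<close>
  define R where "R A B \<longleftrightarrow> A \<subseteq> B \<and> measure M A < measure M B" for A B :: "'a set"
  interpret R: pred_on "sets M" R .
  obtain C where C: "R.maxchain C"
    using R.Hausdorff by blast
  have C_sets: "A \<in> sets M" if "A \<in> C" for A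
    using C that unfolding R.maxchain_def R.chain_def by auto
  have C_total: "A = B \<or> R A B \<or> R B A" if "A \<in> C" "B \<in> C" for A B
    using C that unfolding R.maxchain_def R.chain_def by auto
  \<comment> \<open>Maximality in usable form: a measurable set comparable with every member is
    itself a member.\<close>
  have C_max: "X \<in> C" if X: "X \<in> sets M" "\<And>B. B \<in> C \<Longrightarrow> X = B \<or> R X B \<or> R B X" for X
  proof (rule ccontr)
    assume "X \<notin> C"
    moreover have "R.chain (insert X C)"
      using C X unfolding R.maxchain_def R.chain_def by auto
    ultimately show False
      using C unfolding R.maxchain_def by blast
  qed
  have C_mono: "A \<subseteq> B" "measure M A < measure M B \<Longrightarrow> R A B"
    if "A \<in> C" "B \<in> C" "measure M A \<le> measure M B" for A B
    using C_total[OF that(1,2)] that(3) by (auto simp: R_def)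
  have C_chain: "A \<subseteq> B \<or> B \<subseteq> A" if "A \<in> C" "B \<in> C" for A B
    using C_total[OF that] by (auto simp: R_def)
  \<comment> \<open>Among the members of measure at most \<open>t\<close>, one has the largest
    measure. Otherwise the union of members approaching the supremum could be added to the
    chain.\<close>
  have lower: "\<exists>A\<in>C. measure M A \<le> t \<and> (\<forall>B\<in>C. measure M B \<le> t \<longrightarrow> measure M B \<le> measure M A)"
    if "0 \<le> t" for t
  proof (rule ccontr)
    define L where "L = {A\<in>C. measure M A \<le> t}"
    define a where "a = Sup (measure M ` L)"
    assume "\<not> ?thesis"
    then have *: "\<exists>B\<in>L. measure M A < measure M B" if "A \<in> L" for A
      using that by (fastforce simp: L_def not_le)
    have "L \<noteq> {}"
    proof
      assume "L = {}"
      then have "measure M B > 0" if "B \<in> C" for B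
        using that \<open>0 \<le> t\<close> by (force simp: L_def not_le)
      \<comment> \<open>All members have positive measure here, so the empty set is
        \<open>R\<close>-below each of them.\<close>
      then have "{} \<in> C"
        by (intro C_max) (auto simp: R_def)
      then show False
        using \<open>L = {}\<close> \<open>0 \<le> t\<close> by (auto simp: L_def)
    qed
    have bdd: "bdd_above (measure M ` L)"
      by (auto simp: L_def bdd_above_def)
    have lt: "measure M A < a" if "A \<in> L" for A
      using *[OF that] bdd by (auto simp: a_def intro: less_le_trans cSup_upper)
    have "\<exists>A\<in>L. a - 1 / real (Suc n) < measure M A" for n
    proof -
      have "a - 1 / real (Suc n) < a" by simp
      then show ?thesis
        using less_cSup_iff[OF _ bdd] \<open>L \<noteq> {}\<close> unfolding a_def by auto
    qed
    then obtain f where f: "\<And>n. f n \<in> L" "\<And>n. a - 1 / real (Suc n) < measure M (f n)"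
      by metis
    define X where "X = (\<Union>n. f n)"
    have f_sets: "range f \<subseteq> sets M"
      using f(1) C_sets by (auto simp: L_def)
    then have X: "X \<in> sets M"
      by (auto simp: X_def)
    have fX: "measure M (f n) \<le> measure M X" "f n \<subseteq> X" for n
      using X f_sets by (auto simp: X_def intro: finite_measure_mono)
    have Xt: "measure M X \<le> t"
      unfolding X_def using f(1) C_chain f_sets
      by (intro measure_Union_chain_le) (auto simp: L_def)
    \<comment> \<open>Strictness comes from the supremum \<open>a\<close> not being attained: some
      \<open>f n\<close> already exceeds \<open>B\<close> in measure.\<close>
    have below: "R B X" if B: "B \<in> L" for B
    proof -
      obtain n where "1 / real (Suc n) < a - measure M B"
        using lt[OF B] nat_approx_posE[of "a - measure M B"] by auto
      then have "measure M B < measure M (f n)"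
        using f(2)[of n] by linarith
      then have "R B (f n)"
        using f(1)[of n] B by (intro C_mono) (auto simp: L_def)
      then show ?thesis
        using fX[of n] by (auto simp: R_def)
    qed
    have above: "R X B" if "B \<in> C" "B \<notin> L" for B
    proof -
      have "f n \<subseteq> B" for n
        using that f(1)[of n] by (intro C_mono) (auto simp: L_def)
      then show ?thesis
        using that Xt by (auto simp: R_def X_def L_def)
    qed
    have "X \<in> C"
      using X below above by (intro C_max) auto
    then have "X \<in> L"
      using Xt by (simp add: L_def)
    then show False
      using below by (auto simp: R_def)
  qed
  have upper: "\<exists>A\<in>C. t \<le> measure M A \<and> (\<forall>B\<in>C. t \<le> measure M B \<longrightarrow> measure M A \<le> measure M B)"
    if "t \<le> measure M (space M)" for t
  proof (rule ccontr)
    define L where "L = {A\<in>C. t \<le> measure M A}"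
    define a where "a = Inf (measure M ` L)"
    assume "\<not> ?thesis"
    then have *: "\<exists>B\<in>L. measure M B < measure M A" if "A \<in> L" for A
      using that by (fastforce simp: L_def not_le)
    have "L \<noteq> {}"
    proof
      assume "L = {}"
      then have "measure M B < measure M (space M)" if "B \<in> C" for B
        using that \<open>t \<le> measure M (space M)\<close> by (force simp: L_def not_le)
      then have "space M \<in> C"
        by (intro C_max) (auto simp: R_def dest: C_sets sets.sets_into_space)
      then show False
        using \<open>L = {}\<close> \<open>t \<le> measure M (space M)\<close> by (auto simp: L_def)
    qed
    have bdd: "bdd_below (measure M ` L)"
      by (auto simp: L_def bdd_below_def)
    have lt: "a < measure M A" if "A \<in> L" for A
      using *[OF that] bdd by (auto simp: a_def intro: le_less_trans[OF cInf_lower])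
    have "\<exists>A\<in>L. measure M A < a + 1 / real (Suc n)" for n
    proof -
      have "a < a + 1 / real (Suc n)" by simp
      then show ?thesis
        using cInf_lessD[of "measure M ` L" "a + 1 / real (Suc n)"] \<open>L \<noteq> {}\<close>
        by (simp add: a_def del: of_nat_Suc)
    qed
    then obtain f where f: "\<And>n. f n \<in> L" "\<And>n. measure M (f n) < a + 1 / real (Suc n)"
      by metis
    define X where "X = (\<Inter>n. f n)"
    have f_sets: "range f \<subseteq> sets M"
      using f(1) C_sets by (auto simp: L_def)
    then have X: "X \<in> sets M"
      unfolding X_def by (intro sets.countable_INT) auto
    have fX: "measure M X \<le> measure M (f n)" "X \<subseteq> f n" for n
      using X f_sets by (auto simp: X_def intro!: finite_measure_mono)
    have Xt: "t \<le> measure M X"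
      unfolding X_def using f(1) C_chain f_sets
      by (intro measure_Inter_chain_ge) (auto simp: L_def)
    have above: "R X B" if B: "B \<in> L" for B
    proof -
      obtain n where "1 / real (Suc n) < measure M B - a"
        using lt[OF B] nat_approx_posE[of "measure M B - a"] by auto
      then have "measure M (f n) < measure M B"
        using f(2)[of n] by linarith
      then have "R (f n) B"
        using f(1)[of n] B by (intro C_mono) (auto simp: L_def)
      then show ?thesis
        using fX[of n] by (auto simp: R_def)
    qed
    have below: "R B X" if "B \<in> C" "B \<notin> L" for B
    proof -
      have "B \<subseteq> f n" for n
        using that f(1)[of n] by (intro C_mono) (auto simp: L_def)
      then show ?thesis
        using that Xt by (auto simp: R_def X_def L_def)
    qed
    have "X \<in> C"
      using X below above by (intro C_max) auto
    then have "X \<in> L"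
      using Xt by (simp add: L_def)
    then show False
      using above by (auto simp: R_def)
  qed
  have attained: "\<exists>A\<in>C. measure M A = t" if t: "t \<in> {0..measure M (space M)}" for t
  proof (rule ccontr)
    assume none: "\<not> ?thesis"
    obtain A where A: "A \<in> C" "measure M A \<le> t"
        "\<And>B. B \<in> C \<Longrightarrow> measure M B \<le> t \<Longrightarrow> measure M B \<le> measure M A"
      using lower[of t] t by auto
    obtain A' where A': "A' \<in> C" "t \<le> measure M A'"
        "\<And>B. B \<in> C \<Longrightarrow> t \<le> measure M B \<Longrightarrow> measure M A' \<le> measure M B"
      using upper[of t] t by auto
    have lt: "measure M A < t" "t < measure M A'"
      using none A A' by force+
    then have "A \<subseteq> A'"
      using A A' by (intro C_mono) auto
    then have "measure M (A' - A) = measure M A' - measure M A"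
      using A A' C_sets by (intro finite_measure_Diff) auto
    moreover have "A' - A \<in> sets M"
      using A A' C_sets by auto
    \<comment> \<open>Atomlessness splits the gap set \<open>A' - A\<close>, so
      \<open>A \<union> E\<close> lies strictly between the neighbours \<open>A\<close> and
      \<open>A'\<close> of the missing value \<open>t\<close>.\<close>
    ultimately obtain E where E: "E \<in> sets M" "E \<subseteq> A' - A" "0 < measure M E"
        "measure M E < measure M A' - measure M A"
      using assms lt unfolding atomless_def by (smt (verit, best))
    define X where "X = A \<union> E"
    have X: "X \<in> sets M" "A \<subseteq> X" "X \<subseteq> A'"
      using E A C_sets \<open>A \<subseteq> A'\<close> by (auto simp: X_def)
    have "measure M X = measure M A + measure M E"
      unfolding X_def using E A C_sets by (intro finite_measure_Union) auto
    then have mX: "measure M A < measure M X" "measure M X < measure M A'"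
      using E by auto
    have "X = B \<or> R X B \<or> R B X" if "B \<in> C" for B
    proof (cases "measure M B \<le> t")
      case True
      then have "B \<subseteq> A" "measure M B \<le> measure M A"
        using A C_mono that by blast+
      then show ?thesis
        using X mX by (auto simp: R_def)
    next
      case False
      then have "A' \<subseteq> B" "measure M A' \<le> measure M B"
        using A' C_mono that by (meson linear)+
      then show ?thesis
        using X mX by (auto simp: R_def)
    qed
    then have "X \<in> C"
      using X by (intro C_max)
    \<comment> \<open>The measure of \<open>X\<close> is at most \<open>t\<close> or at least
      \<open>t\<close>, against the extremality of \<open>A\<close> or of \<open>A'\<close>.\<close>
    then show False
      using A(3)[of X] A'(3)[of X] mX by linarith
  qed
  then obtain B where B: "\<And>t. t \<in> {0..measure M (space M)} \<Longrightarrow> B t \<in> C"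
      "\<And>t. t \<in> {0..measure M (space M)} \<Longrightarrow> measure M (B t) = t"
    by metis
  show ?thesis
  proof
    show "mono_on {0..measure M (space M)} B"
      using B C_mono by (intro mono_onI) auto
  qed (use B C_sets in auto)
qed

text \<open>\<open>U \<omega>\<close> is the level at which \<omega> enters the increasing family
  \<open>B r\<close>. Since \<open>B x\<close> has measure \<open>x\<close>, this entry level is
  uniform.\<close>

lemma (in prob_space) atomless_uniform:
  assumes "atomless M"
  obtains U :: "'a \<Rightarrow> real"
  where "U \<in> borel_measurable M"
    and "\<And>x. x \<in> {0..1} \<Longrightarrow> prob {\<omega>\<in>space M. U \<omega> \<le> x} = x"
    and "AE \<omega> in M. U \<omega> \<in> {0<..<1}"
proof -
  obtain B where B: "\<And>t. t \<in> {0..1} \<Longrightarrow> B t \<in> sets M"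
      "\<And>t. t \<in> {0..1} \<Longrightarrow> prob (B t) = t" "mono_on {0..1} B"
    using atomless_increasing_family[OF assms] unfolding prob_space by metis
  \<comment> \<open>The inserted 1 keeps the set non-empty for points lying in no
    \<open>B r\<close>; \<open>B 1\<close> has full measure but need not be the whole space.\<close>
  define S where "S \<omega> = insert 1 {r\<in>{0..1}. \<omega> \<in> B r}" for \<omega>
  define U where "U \<omega> = Inf (S \<omega>)" for \<omega>
  have S: "bdd_below (S \<omega>)" "S \<omega> \<noteq> {}" for \<omega>
    by (auto simp: S_def bdd_below_def intro: exI[of _ 0])
  have U01: "0 \<le> U \<omega>" "U \<omega> \<le> 1" for \<omega>
    unfolding U_def using S[of \<omega>] by (auto simp: S_def intro!: cInf_lower cInf_greatest)
  \<comment> \<open>For \<open>x < 1\<close> this decreases to \<open>x\<close> from strictly above,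
    starting at 1. The infimum in \<open>U\<close> need not be attained, so
    \<open>U \<omega> \<le> x\<close> only yields membership in \<open>B r\<close> for levels
    \<open>r > x\<close>.\<close>
  define d where "d x n = x + (1 - x) / real (Suc n)" for x n
  have d_tendsto: "d x \<longlonglongrightarrow> x" for x
  proof -
    have "(\<lambda>n. x + (1 - x) * (1 / real (Suc n))) \<longlonglongrightarrow> x + (1 - x) * 0"
      by (intro tendsto_intros LIMSEQ_Suc lim_1_over_n)
    then show ?thesis
      by (simp add: d_def[abs_def])
  qed
  have d: "d x n \<in> {0..1}" "x < d x n" "decseq (d x)" if "x \<in> {0..<1}" for x n
  proof -
    have *: "(1 - x) / real (Suc n) \<le> 1 - x"
      using that by (auto simp: divide_simps mult_le_cancel_left1)
    have "0 < (1 - x) / real (Suc n)"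
      using that by simp
    with * that show "d x n \<in> {0..1}" "x < d x n"
      unfolding d_def by auto
    show "decseq (d x)"
      using that by (auto simp: decseq_def d_def intro!: divide_left_mono)
  qed
  have sub: "{\<omega>\<in>space M. U \<omega> \<le> x} = (\<Inter>n. B (d x n))" if x: "x \<in> {0..<1}" for x
  proof (intro equalityI subsetI)
    fix \<omega> assume "\<omega> \<in> {\<omega>\<in>space M. U \<omega> \<le> x}"
    then have *: "\<exists>r\<in>S \<omega>. r < d x n" for n
      using d(2)[OF x, of n] S cInf_less_iff[of "S \<omega>" "d x n"] by (auto simp: U_def)
    have "\<omega> \<in> B (d x n)" for n
    proof -
      obtain r where r: "r \<in> S \<omega>" "r < d x n"
        using * by blast
      then have "r \<in> {0..1}" "\<omega> \<in> B r"
        using d(1)[OF x, of n] by (auto simp: S_def)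
      then show ?thesis
        using r monotone_onD[OF B(3), of r "d x n"] d(1)[OF x, of n] by auto
    qed
    then show "\<omega> \<in> (\<Inter>n. B (d x n))" by blast
  next
    fix \<omega> assume *: "\<omega> \<in> (\<Inter>n. B (d x n))"
    then have "U \<omega> \<le> d x n" for n
      unfolding U_def using d(1)[OF x] S by (intro cInf_lower) (auto simp: S_def)
    then have "U \<omega> \<le> x"
      using LIMSEQ_le_const[OF d_tendsto[of x]] by blast
    moreover have "\<omega> \<in> space M"
      using * B(1)[OF d(1)[OF x, of 0]] sets.sets_into_space by blast
    ultimately show "\<omega> \<in> {\<omega>\<in>space M. U \<omega> \<le> x}" by simp
  qed
  have U: "U \<in> borel_measurable M"
    unfolding borel_measurable_iff_le
  proof
    fix x :: real
    consider "x < 0" | "x \<in> {0..<1}" | "1 \<le> x" by force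
    then show "{\<omega>\<in>space M. U \<omega> \<le> x} \<in> sets M"
    proof cases
      case 1
      then have "\<not> U \<omega> \<le> x" for \<omega>
        using U01(1)[of \<omega>] by linarith
      then show ?thesis by simp
    next
      case 2
      then show ?thesis
        unfolding sub[OF 2] using B d(1)[OF 2] by (intro sets.countable_INT) auto
    next
      case 3
      then have "U \<omega> \<le> x" for \<omega>
        using U01(2)[of \<omega>] by linarith
      then show ?thesis by simp
    qed
  qed
  have prob: "prob {\<omega>\<in>space M. U \<omega> \<le> x} = x" if "x \<in> {0..1}" for x
  proof (cases "x = 1")
    case True
    then show ?thesis
      using U01 by (simp add: prob_space)
  next
    case False
    with that have x: "x \<in> {0..<1}" by auto
    have "B (d x n) \<subseteq> B (d x m)" if "m \<le> n" for m n
      using d(1,3)[OF x] that by (intro monotone_onD[OF B(3)]) (auto simp: decseq_def)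
    then have "(\<lambda>n. prob (B (d x n))) \<longlonglongrightarrow> prob (\<Inter>n. B (d x n))"
      using B d(1)[OF x] by (intro finite_Lim_measure_decseq) (auto simp: decseq_def)
    moreover have "(\<lambda>n. prob (B (d x n))) = d x"
      using B d[OF x] by auto
    ultimately show ?thesis
      using d_tendsto[of x] LIMSEQ_unique unfolding sub[OF x] by metis
  qed
  have "AE \<omega> in M. 0 < U \<omega>"
  proof -
    have "prob {\<omega>\<in>space M. \<not> 0 < U \<omega>} = 0"
      using prob[of 0] by (simp add: not_less)
    then show ?thesis
      using U by (subst AE_iff_measurable[OF _ refl]) (auto simp: emeasure_eq_measure)
  qed
  moreover have "AE \<omega> in M. U \<omega> < 1"
  proof -
    have "1 \<le> prob {\<omega>\<in>space M. U \<omega> < 1} + e" if "0 < e" for e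
    proof (cases "e < 1")
      case True
      have "prob {\<omega>\<in>space M. U \<omega> \<le> 1 - e} \<le> prob {\<omega>\<in>space M. U \<omega> < 1}"
        using U that by (intro finite_measure_mono) auto
      then show ?thesis
        using prob[of "1 - e"] that True by simp
    next
      case False
      then show ?thesis
        by (simp add: add_increasing)
    qed
    then have "1 \<le> prob {\<omega>\<in>space M. U \<omega> < 1}"
      by (rule field_le_epsilon)
    then have "prob {\<omega>\<in>space M. U \<omega> < 1} = 1"
      using prob_le_1 by (intro antisym)
    then show ?thesis
      using U by (subst (asm) prob_Collect_eq_1) auto
  qed
  ultimately have "AE \<omega> in M. U \<omega> \<in> {0<..<1}"
    by eventually_elim auto
  with U prob show thesis
    using that by blast
qed

subsection \<open>Quantile functions and suprema in the stochastic order\<close>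

text \<open>For a nondecreasing \<open>q\<close> the third assumption is left-continuity.\<close>

lemma (in prob_space) atomless_realize_quantile:
  fixes q :: "real \<Rightarrow> real"
  assumes "atomless M"
    and mono: "\<And>u w. 0 < u \<Longrightarrow> u \<le> w \<Longrightarrow> w < 1 \<Longrightarrow> q u \<le> q w"
    and left: "\<And>u v. u \<in> {0<..<1} \<Longrightarrow> (\<And>w. w \<in> {0<..<u} \<Longrightarrow> q w \<le> v) \<Longrightarrow> q u \<le> v"
  obtains X where "X \<in> borel_measurable M" "\<And>u. u \<in> {0<..<1} \<Longrightarrow> rv_quantile M X u = q u"
proof -
  obtain U where U: "U \<in> borel_measurable M"
      "\<And>x. x \<in> {0..1} \<Longrightarrow> prob {\<omega>\<in>space M. U \<omega> \<le> x} = x"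
      "AE \<omega> in M. U \<omega> \<in> {0<..<1}"
    using atomless_uniform[OF assms(1)] by blast
  \<comment> \<open>Quantile transform of a uniform variable; the value 0 is used only on a null
    set.\<close>
  define X where "X \<omega> = (if U \<omega> \<in> {0<..<1} then q (U \<omega>) else 0)" for \<omega>
  \<comment> \<open>The resulting \<open>c\<close> will be the distribution function of
    \<open>X\<close>. The inserted 0 gives \<open>c v = 0\<close> when no \<open>q u\<close> is at
    most \<open>v\<close>.\<close>
  define S where "S v = insert 0 {u\<in>{0<..<1}. q u \<le> v}" for v
  define c where "c v = Sup (S v)" for v
  have S: "bdd_above (S v)" "S v \<noteq> {}" for v
    by (auto simp: S_def bdd_above_def intro!: exI[of _ 1])
  have c01: "c v \<in> {0..1}" for v
    unfolding c_def using S[of v]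
    by (auto simp: S_def intro!: cSup_upper cSup_least)
  \<comment> \<open>\<open>q\<close> and \<open>c\<close> form a Galois connection. Left-continuity
    of \<open>q\<close> makes the backward direction reach \<open>u = c v\<close>.\<close>
  have galois: "q u \<le> v \<longleftrightarrow> u \<le> c v" if u: "u \<in> {0<..<1}" for u v
  proof
    assume "q u \<le> v"
    then show "u \<le> c v"
      unfolding c_def using u S by (intro cSup_upper) (auto simp: S_def)
  next
    assume *: "u \<le> c v"
    show "q u \<le> v"
    proof (rule left[OF u])
      fix w assume w: "w \<in> {0<..<u}"
      then have "w < c v"
        using * by auto
      then obtain y where "y \<in> S v" "w < y"
        unfolding c_def using S less_cSup_iff by blast
      then have "y \<in> {0<..<1}" "q y \<le> v"
        using w by (auto simp: S_def)
      then show "q w \<le> v"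
        using mono[of w y] w \<open>w < y\<close> by auto
    qed
  qed
  have X_le: "{\<omega>\<in>space M. X \<omega> \<le> v} =
      {\<omega>\<in>space M. if U \<omega> \<in> {0<..<1} then U \<omega> \<le> c v else 0 \<le> v}" for v
    using galois by (auto simp: X_def)
  have X: "X \<in> borel_measurable M"
    unfolding borel_measurable_iff_le X_le
  proof
    note U(1)[measurable]
    show "{\<omega>\<in>space M. if U \<omega> \<in> {0<..<1} then U \<omega> \<le> c v else 0 \<le> v} \<in> sets M" for v
      unfolding if_bool_eq_disj greaterThanLessThan_iff by measurable
  qed
  have prob_X: "prob {\<omega>\<in>space M. X \<omega> \<le> v} = c v" for v
  proof -
    have "AE \<omega> in M. X \<omega> \<le> v \<longleftrightarrow> U \<omega> \<le> c v"
      using U(3) by eventually_elim (simp add: X_def galois)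
    then have "prob {\<omega>\<in>space M. X \<omega> \<le> v} = prob {\<omega>\<in>space M. U \<omega> \<le> c v}"
      using X U(1) by (intro finite_measure_eq_AE) auto
    then show ?thesis
      using U(2)[OF c01] by simp
  qed
  have "rv_quantile M X u = q u" if "u \<in> {0<..<1}" for u
    unfolding rv_quantile_def prob_X galois[OF that, symmetric]
    by (simp add: atLeast_def[symmetric])
  with X that show thesis by blast
qed

lemma rv_classesE:
  assumes "\<xi> \<in> rv_classes M"
  obtains X where "X \<in> \<xi>" "X \<in> borel_measurable M" "\<xi> = same_law M `` {X}"
  using assms equiv_class_self[OF equiv_same_law] unfolding rv_classes_def
  by (metis quotientE)

text \<open>The quantile is the pseudo-inverse \<open>I\<close> of the distribution function, and
  right-continuity of the latter makes the two adjoint. Monotonicity, left-continuity and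
  injectivity of quantiles all rest on this.\<close>

lemma (in prob_space) quantile_le_iff:
  assumes "\<xi> \<in> rv_classes M" "X \<in> \<xi>" "X \<in> borel_measurable M" "u \<in> {0<..<1}"
  shows "quantile M \<xi> u \<le> v \<longleftrightarrow> u \<le> cdf (distr M borel X) v"
proof -
  interpret D: prob_space "distr M borel X"
    using assms(3) by (rule prob_space_distr)
  interpret cdf_distribution "distr M borel X"
    by unfold_locales auto
  have "prob {\<omega>\<in>space M. X \<omega> \<le> w} = cdf (distr M borel X) w" for w
    using assms(3) unfolding cdf_def
    by (subst measure_distr) (auto simp: vimage_def Int_def intro!: arg_cong[where f = prob])
  then have "quantile M \<xi> u = I u"
    using assms(1,2) by (simp add: quantile_class rv_quantile_def)
  then show ?thesis
    using pseudoinverse[of u v] assms(4) by simp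
qed

lemma (in prob_space) quantile_mono:
  assumes "\<xi> \<in> rv_classes M" "0 < u" "u \<le> w" "w < 1"
  shows "quantile M \<xi> u \<le> quantile M \<xi> w"
proof -
  obtain X where X: "X \<in> \<xi>" "X \<in> borel_measurable M"
    using assms(1) by (rule rv_classesE)
  have "w \<le> cdf (distr M borel X) (quantile M \<xi> w)"
    using quantile_le_iff[OF assms(1) X, of w] assms by auto
  then show ?thesis
    using quantile_le_iff[OF assms(1) X, of u] assms by auto
qed

text \<open>Left-continuity written as an inequality, the form that survives pointwise suprema. The
  \<open>u\<close> with quantile at most \<open>v\<close> are those up to
  \<open>cdf (distr M borel X) v\<close>, end point included.\<close>

lemma (in prob_space) quantile_left_continuous:
  assumes "\<xi> \<in> rv_classes M" "u \<in> {0<..<1}"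
    and "\<And>w. w \<in> {0<..<u} \<Longrightarrow> quantile M \<xi> w \<le> v"
  shows "quantile M \<xi> u \<le> v"
proof -
  obtain X where X: "X \<in> \<xi>" "X \<in> borel_measurable M"
    using assms(1) by (rule rv_classesE)
  have "w \<le> cdf (distr M borel X) v" if "0 < w" "w < u" for w
    using quantile_le_iff[OF assms(1) X, of w] assms that by auto
  then have "u \<le> cdf (distr M borel X) v"
    using assms(2) by (intro dense_le_bounded[of 0 u]) auto
  then show ?thesis
    using quantile_le_iff[OF assms(1) X assms(2)] by auto
qed

text \<open>Equal quantiles decide \<open>u \<le> cdf _ v\<close> alike for every \<open>u\<close>
  in the open unit interval; these comparisons pin down the distribution function and thereby the
  law.\<close>

lemma (in prob_space) quantile_inj:
  assumes "\<xi> \<in> rv_classes M" "\<eta> \<in> rv_classes M"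
    and "\<And>u. u \<in> {0<..<1} \<Longrightarrow> quantile M \<xi> u = quantile M \<eta> u"
  shows "\<xi> = \<eta>"
proof -
  obtain X where X: "X \<in> \<xi>" "X \<in> borel_measurable M" "\<xi> = same_law M `` {X}"
    using assms(1) by (rule rv_classesE)
  obtain Y where Y: "Y \<in> \<eta>" "Y \<in> borel_measurable M" "\<eta> = same_law M `` {Y}"
    using assms(2) by (rule rv_classesE)
  interpret X: prob_space "distr M borel X"
    using X(2) by (rule prob_space_distr)
  interpret X: real_distribution "distr M borel X"
    by unfold_locales auto
  interpret Y: prob_space "distr M borel Y"
    using Y(2) by (rule prob_space_distr)
  interpret Y: real_distribution "distr M borel Y"
    by unfold_locales auto
  have iff: "u \<le> cdf (distr M borel X) v \<longleftrightarrow> u \<le> cdf (distr M borel Y) v" if "u \<in> {0<..<1}" for u v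
    using quantile_le_iff[OF assms(1) X(1,2) that] quantile_le_iff[OF assms(2) Y(1,2) that]
      assms(3)[OF that] by simp
  \<comment> \<open>If \<open>b < a\<close>, any \<open>u\<close> strictly between them lies in the
    open unit interval and refutes the premise.\<close>
  have le: "a \<le> b"
    if "\<And>u. u \<in> {0<..<1} \<Longrightarrow> u \<le> a \<Longrightarrow> u \<le> b" "0 \<le> a" "a \<le> 1" "0 \<le> b" for a b :: real
  proof (rule ccontr)
    assume "\<not> ?thesis"
    then obtain u where "b < u" "u < a"
      using dense[of b a] by auto
    then show False
      using that(1)[of u] that(2-) by auto
  qed
  have "cdf (distr M borel X) v = cdf (distr M borel Y) v" for v
  proof (rule antisym)
    show "cdf (distr M borel X) v \<le> cdf (distr M borel Y) v"
      by (rule le) (simp_all add: iff X.cdf_nonneg Y.cdf_nonneg X.cdf_bounded_prob)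
    show "cdf (distr M borel Y) v \<le> cdf (distr M borel X) v"
      by (rule le) (simp_all add: iff X.cdf_nonneg Y.cdf_nonneg Y.cdf_bounded_prob)
  qed
  then have "distr M borel X = distr M borel Y"
    by (intro cdf_unique X.real_distribution_axioms Y.real_distribution_axioms ext)
  then have "(X, Y) \<in> same_law M"
    using X Y by (simp add: same_law_def)
  then show ?thesis
    using X(3) Y(3) equiv_class_eq[OF equiv_same_law] by simp
qed

text \<open>Monotonicity and the inequality form of left-continuity both pass to pointwise suprema,
  so a finite pointwise supremum of quantile functions is realised by a random variable.\<close>

lemma (in prob_space) ex_pointwise_Sup:
  assumes "atomless M" "Y \<subseteq> rv_classes M" "Y \<noteq> {}"
    and bdd: "\<And>u. u \<in> {0<..<1} \<Longrightarrow> bdd_above ((\<lambda>y. quantile M y u) ` Y)"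
  obtains \<sigma> where "\<sigma> \<in> rv_classes M"
    "\<And>u. u \<in> {0<..<1} \<Longrightarrow> quantile M \<sigma> u = (SUP y\<in>Y. quantile M y u)"
proof -
  define q where "q u = (SUP y\<in>Y. quantile M y u)" for u
  have q_upper: "quantile M y u \<le> q u" if "y \<in> Y" "u \<in> {0<..<1}" for y u
    unfolding q_def using bdd that by (intro cSUP_upper)
  have q_least: "q u \<le> v" if "\<And>y. y \<in> Y \<Longrightarrow> quantile M y u \<le> v" for u v
    unfolding q_def using assms(3) that by (intro cSUP_least)
  have mono: "q u \<le> q w" if "0 < u" "u \<le> w" "w < 1" for u w
  proof (rule q_least)
    fix y assume "y \<in> Y"
    then show "quantile M y u \<le> q w"
      using quantile_mono[of y u w] q_upper[of y w] assms(2) that by fastforce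
  qed
  have left: "q u \<le> v" if "u \<in> {0<..<1}" "\<And>w. w \<in> {0<..<u} \<Longrightarrow> q w \<le> v" for u v
  proof (rule q_least)
    fix y assume y: "y \<in> Y"
    show "quantile M y u \<le> v"
    proof (rule quantile_left_continuous)
      show "quantile M y w \<le> v" if "w \<in> {0<..<u}" for w
        using that(1) \<open>u \<in> {0<..<1}\<close> \<open>w \<in> {0<..<u} \<Longrightarrow> q w \<le> v\<close> q_upper[OF y, of w] by auto
    qed (use y assms(2) that in auto)
  qed
  obtain X where X: "X \<in> borel_measurable M" "\<And>u. u \<in> {0<..<1} \<Longrightarrow> rv_quantile M X u = q u"
  proof (rule atomless_realize_quantile[OF assms(1)])
    show "q u \<le> q w" if "0 < u" "u \<le> w" "w < 1" for u w
      using that by (rule mono)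
    show "q u \<le> v" if "u \<in> {0<..<1}" "\<And>w. w \<in> {0<..<u} \<Longrightarrow> q w \<le> v" for u v
      using that by (rule left)
  qed blast
  define \<sigma> where "\<sigma> = same_law M `` {X}"
  have \<sigma>: "\<sigma> \<in> rv_classes M" "X \<in> \<sigma>"
    using X(1) equiv_class_self[OF equiv_same_law] by (auto simp: \<sigma>_def rv_classes_def quotientI)
  show thesis
    using that[OF \<sigma>(1)] X(2) quantile_class[OF \<sigma>] by (simp add: q_def)
qed

text \<open>Justifies the definite description in \<open>st_Sup\<close>: the class realising the
  pointwise supremum is a least upper bound, and antisymmetry through \<open>quantile_inj\<close>
  makes it the only one.\<close>

lemma (in prob_space) st_Sup_least_upper:
  assumes "atomless M" "Y \<subseteq> rv_classes M" "Y \<noteq> {}" "st_upper M Y \<eta>\<^sub>0"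
  shows "st_upper M Y (st_Sup M Y) \<and> (\<forall>\<eta>. st_upper M Y \<eta> \<longrightarrow> st_le M (st_Sup M Y) \<eta>)"
proof -
  have bdd: "bdd_above ((\<lambda>y. quantile M y u) ` Y)" if "u \<in> {0<..<1}" for u
    using assms(4) that by (intro bdd_aboveI2[of _ _ "quantile M \<eta>\<^sub>0 u"]) (auto simp: st_upper_def st_le_def)
  obtain \<sigma> where \<sigma>: "\<sigma> \<in> rv_classes M"
      "\<And>u. u \<in> {0<..<1} \<Longrightarrow> quantile M \<sigma> u = (SUP y\<in>Y. quantile M y u)"
    using ex_pointwise_Sup[OF assms(1-3) bdd] by blast
  have lub: "st_upper M Y \<sigma> \<and> (\<forall>\<eta>. st_upper M Y \<eta> \<longrightarrow> st_le M \<sigma> \<eta>)"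
    using \<sigma> bdd assms(3) by (auto simp: st_upper_def st_le_def intro!: cSUP_upper cSUP_least)
  show ?thesis
    unfolding st_Sup_def
  proof (rule theI', rule ex1I)
    show "st_upper M Y \<sigma> \<and> (\<forall>\<eta>. st_upper M Y \<eta> \<longrightarrow> st_le M \<sigma> \<eta>)"
      by (fact lub)
  next
    fix \<tau> assume "st_upper M Y \<tau> \<and> (\<forall>\<eta>. st_upper M Y \<eta> \<longrightarrow> st_le M \<tau> \<eta>)"
    then show "\<tau> = \<sigma>"
      using lub by (intro quantile_inj antisym) (auto simp: st_upper_def st_le_def)
  qed
qed

subsection \<open>Sublevel sets\<close>

text \<open>Reduces the order to countably many tests, so that a countable family can control a
  whole sublevel set. Any \<open>w < u\<close> is separated from \<open>u\<close> by a rational, and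
  left-continuity lets \<open>w\<close> tend to \<open>u\<close>.\<close>

lemma (in prob_space) st_leI_rational:
  assumes "\<xi> \<in> rv_classes M" "\<eta> \<in> rv_classes M"
    and "\<And>r. r \<in> \<rat> \<inter> {0<..<1} \<Longrightarrow> quantile M \<xi> r \<le> quantile M \<eta> r"
  shows "st_le M \<xi> \<eta>"
  unfolding st_le_def
proof (rule ballI, rule quantile_left_continuous[OF assms(1)])
  fix u w :: real assume u: "u \<in> {0<..<1}" and w: "w \<in> {0<..<u}"
  then obtain r where r: "r \<in> \<rat>" "w < r" "r < u"
    using Rats_dense_in_real[of w u] by auto
  have "quantile M \<xi> w \<le> quantile M \<xi> r"
    using assms(1) r u w by (intro quantile_mono) auto
  also have "\<dots> \<le> quantile M \<eta> r"
    using r u w by (intro assms(3)) auto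
  also have "\<dots> \<le> quantile M \<eta> u"
    using assms(2) r u w by (intro quantile_mono) auto
  finally show "quantile M \<xi> w \<le> quantile M \<eta> u" .
qed

lemma (in prob_space) sublevel_greatest:
  assumes "countably_directed_sublevels M \<psi>" "sublevel M \<psi> s \<noteq> {}"
  obtains y where "y \<in> sublevel M \<psi> s"
    "\<And>u. u \<in> {0<..<1} \<Longrightarrow> alpha_min M \<psi> s u = ereal (quantile M y u)"
proof -
  have "\<exists>f. range f \<subseteq> sublevel M \<psi> s \<and> alpha_min M \<psi> s r = (SUP n::nat. ereal (quantile M (f n) r))" for r
  proof -
    obtain g :: "nat \<Rightarrow> ereal" where g: "range g \<subseteq> (\<lambda>\<xi>. ereal (quantile M \<xi> r)) ` sublevel M \<psi> s"
        "alpha_min M \<psi> s r = Sup (range g)"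
      using SUP_countable_SUP[OF assms(2), of "\<lambda>\<xi>. ereal (quantile M \<xi> r)"]
      unfolding alpha_min_def by metis
    then have "\<exists>\<xi>\<in>sublevel M \<psi> s. g n = ereal (quantile M \<xi> r)" for n
      by blast
    then obtain f where f: "\<And>n. f n \<in> sublevel M \<psi> s" "\<And>n. g n = ereal (quantile M (f n) r)"
      by metis
    then have "g = (\<lambda>n. ereal (quantile M (f n) r))"
      by auto
    with f(1) g(2) show ?thesis
      by (intro exI[of _ f]) auto
  qed
  then have "\<exists>f. \<forall>r. range (f r) \<subseteq> sublevel M \<psi> s \<and>
      alpha_min M \<psi> s r = (SUP n::nat. ereal (quantile M (f r n) r))"
    by (intro choice allI)
  then obtain f where f: "\<And>r. range (f r) \<subseteq> sublevel M \<psi> s"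
      "\<And>r. alpha_min M \<psi> s r = (SUP n::nat. ereal (quantile M (f r n) r))"
    by blast
  \<comment> \<open>Countable, and rich enough to recover \<open>alpha_min M \<psi> s r\<close> at
    each rational \<open>r\<close>; directedness then bounds it by one \<open>y\<close> in the
    sublevel set.\<close>
  define Y where "Y = (\<Union>r\<in>\<rat>. range (f r))"
  have "Y \<subseteq> sublevel M \<psi> s"
    using f(1) by (auto simp: Y_def)
  moreover have "Y \<noteq> {}"
    using Rats_0 by (auto simp: Y_def)
  moreover have "countable Y"
    unfolding Y_def by (intro countable_UN countable_rat) auto
  ultimately obtain y where y: "y \<in> sublevel M \<psi> s" "\<And>z. z \<in> Y \<Longrightarrow> st_le M z y"
    using assms(1) unfolding countably_directed_sublevels_def by metis
  have le: "st_le M \<xi> y" if \<xi>: "\<xi> \<in> sublevel M \<psi> s" for \<xi>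
  proof (rule st_leI_rational)
    fix r :: real assume r: "r \<in> \<rat> \<inter> {0<..<1}"
    have "ereal (quantile M \<xi> r) \<le> alpha_min M \<psi> s r"
      unfolding alpha_min_def using \<xi> by (intro SUP_upper)
    also have "\<dots> \<le> ereal (quantile M y r)"
      unfolding f(2)
    proof (rule SUP_least)
      fix n
      have "st_le M (f r n) y"
        using r by (intro y(2)) (auto simp: Y_def)
      then show "ereal (quantile M (f r n) r) \<le> ereal (quantile M y r)"
        using r by (simp add: st_le_def)
    qed
    finally show "quantile M \<xi> r \<le> quantile M y r" by simp
  qed (use \<xi> y(1) in \<open>simp_all add: sublevel_def\<close>)
  show thesis
  proof
    show "alpha_min M \<psi> s u = ereal (quantile M y u)" if "u \<in> {0<..<1}" for u
      unfolding alpha_min_def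
    proof (rule antisym)
      show "(SUP \<xi>\<in>sublevel M \<psi> s. ereal (quantile M \<xi> u)) \<le> ereal (quantile M y u)"
        using le that by (intro SUP_least) (simp add: st_le_def)
      show "ereal (quantile M y u) \<le> (SUP \<xi>\<in>sublevel M \<psi> s. ereal (quantile M \<xi> u))"
        using y(1) by (intro SUP_upper)
    qed
  qed (fact y(1))
qed

text \<open>For the backward direction, \<open>alpha_min M \<psi> s\<close> is the quantile function
  of the greatest element of the sublevel set, so the right-hand side puts \<xi> below that element
  and monotonicity applies.\<close>

lemma (in prob_space) le_iff_quantile_le_alpha_min:
  assumes "st_monotone M \<psi>" "countably_directed_sublevels M \<psi>" "\<xi> \<in> rv_classes M"
  shows "\<psi> \<xi> \<le> ereal s \<longleftrightarrow> (\<forall>u\<in>{0<..<1}. ereal (quantile M \<xi> u) \<le> alpha_min M \<psi> s u)"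
proof
  assume "\<psi> \<xi> \<le> ereal s"
  then show "\<forall>u\<in>{0<..<1}. ereal (quantile M \<xi> u) \<le> alpha_min M \<psi> s u"
    unfolding alpha_min_def using assms(3) by (intro ballI SUP_upper) (simp add: sublevel_def)
next
  assume *: "\<forall>u\<in>{0<..<1}. ereal (quantile M \<xi> u) \<le> alpha_min M \<psi> s u"
  \<comment> \<open>On an empty sublevel set \<open>alpha_min\<close> is -\<infinity>, so one real
    quantile below it suffices; the point 1/2 is arbitrary.\<close>
  have "ereal (quantile M \<xi> (1/2)) \<le> alpha_min M \<psi> s (1/2)"
    using * by (rule bspec) simp
  then have nonempty: "sublevel M \<psi> s \<noteq> {}"
    by (auto simp: alpha_min_def bot_ereal_def)
  obtain y where y: "y \<in> sublevel M \<psi> s"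
      "\<And>u. u \<in> {0<..<1} \<Longrightarrow> alpha_min M \<psi> s u = ereal (quantile M y u)"
    using sublevel_greatest[OF assms(2) nonempty] by blast
  then have "st_le M \<xi> y"
    using * by (simp add: st_le_def)
  then have "\<psi> \<xi> \<le> \<psi> y"
    using assms(1,3) y(1) by (auto simp: st_monotone_def sublevel_def)
  also have "\<dots> \<le> ereal s"
    using y(1) by (simp add: sublevel_def)
  finally show "\<psi> \<xi> \<le> ereal s" .
qed

text \<open>Common converse for the representations by \<alpha> and by \<open>G_min\<close>, which
  supply different \<beta>. An upper bound on quantile functions is kept by their pointwise
  supremum, and \<open>fin\<close> makes that supremum real-valued.\<close>

lemma (in prob_space) monotone_directed_if_sublevels_below:
  assumes "atomless M"
    and le_iff: "\<And>\<xi> s. \<xi> \<in> rv_classes M \<Longrightarrow>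
      \<psi> \<xi> \<le> ereal s \<longleftrightarrow> (\<forall>u\<in>{0<..<1}. ereal (quantile M \<xi> u) \<le> \<beta> s u)"
    and fin: "\<And>s u. sublevel M \<psi> s \<noteq> {} \<Longrightarrow> u \<in> {0<..<1} \<Longrightarrow> alpha_min M \<psi> s u < \<infinity>"
  shows "st_monotone M \<psi> \<and> countably_directed_sublevels M \<psi>"
proof
  show "st_monotone M \<psi>"
    unfolding st_monotone_def
  \<comment> \<open>The inequality is tested on real upper bounds \<open>z\<close> of
    \<open>\<psi> \<eta>\<close>, since \<open>le_iff\<close> speaks of real levels only.\<close>
  proof (intro ballI impI, rule ereal_le_real)
    fix \<xi> \<eta> z
    assume *: "\<xi> \<in> rv_classes M" "\<eta> \<in> rv_classes M" "st_le M \<xi> \<eta>" "\<psi> \<eta> \<le> ereal z"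
    have "ereal (quantile M \<xi> u) \<le> \<beta> z u" if u: "u \<in> {0<..<1}" for u
    proof -
      have "ereal (quantile M \<xi> u) \<le> ereal (quantile M \<eta> u)"
        using *(3) u by (simp add: st_le_def)
      also have "\<dots> \<le> \<beta> z u"
        using le_iff[OF *(2)] *(4) u by blast
      finally show ?thesis .
    qed
    then show "\<psi> \<xi> \<le> ereal z"
      using le_iff[OF *(1)] by blast
  qed
  show "countably_directed_sublevels M \<psi>"
    unfolding countably_directed_sublevels_def
  proof (intro allI impI)
    fix s Y assume Y: "Y \<subseteq> sublevel M \<psi> s \<and> Y \<noteq> {} \<and> countable Y"
    have bdd: "bdd_above ((\<lambda>y. quantile M y u) ` Y)" if u: "u \<in> {0<..<1}" for u
    proof -
      have le: "ereal (quantile M y u) \<le> alpha_min M \<psi> s u" if "y \<in> Y" for y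
        unfolding alpha_min_def using Y that by (intro SUP_upper) auto
      moreover obtain b where "alpha_min M \<psi> s u \<le> ereal b"
        using fin[OF _ u, of s] Y by (cases "alpha_min M \<psi> s u") auto
      ultimately have "quantile M y u \<le> b" if "y \<in> Y" for y
        using that by (meson ereal_less_eq(3) order_trans)
      then show ?thesis
        by (auto simp: bdd_above_def)
    qed
    have sub: "Y \<subseteq> rv_classes M" "Y \<noteq> {}"
      using Y by (auto simp: sublevel_def)
    obtain \<sigma> where \<sigma>: "\<sigma> \<in> rv_classes M"
        "\<And>u. u \<in> {0<..<1} \<Longrightarrow> quantile M \<sigma> u = (SUP y\<in>Y. quantile M y u)"
      using ex_pointwise_Sup[OF assms(1) sub bdd] by blast
    have "ereal (quantile M \<sigma> u) \<le> \<beta> s u" if u: "u \<in> {0<..<1}" for u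
    proof -
      have "ereal (quantile M y u) \<le> \<beta> s u" if "y \<in> Y" for y
        using that Y le_iff[of y s] u by (auto simp: sublevel_def)
      then show ?thesis
        unfolding \<sigma>(2)[OF u] using \<open>Y \<noteq> {}\<close>
        by (cases "\<beta> s u") (auto intro!: cSUP_least)
    qed
    then have "\<sigma> \<in> sublevel M \<psi> s"
      using \<sigma>(1) le_iff by (simp add: sublevel_def)
    moreover have "st_le M y \<sigma>" if "y \<in> Y" for y
      using that bdd \<sigma>(2) by (auto simp: st_le_def intro!: cSUP_upper)
    ultimately show "\<exists>y'\<in>sublevel M \<psi> s. \<forall>y\<in>Y. st_le M y y'"
      by blast
  qed
qed

text \<open>Forward, maxitivity on a pair gives monotonicity, and the supremum of a countable set is
  its bound inside the sublevel set. Backward, directedness at the level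
  \<open>SUP y\<in>Y. \<psi> y\<close> supplies an upper bound at that same level.\<close>

lemma (in prob_space) bounded_countably_maxitive_iff:
  assumes "atomless M" "\<forall>\<xi>\<in>rv_classes M. \<psi> \<xi> > -\<infinity>"
  shows "bounded_countably_maxitive M \<psi> \<longleftrightarrow>
    st_monotone M \<psi> \<and> countably_directed_sublevels M \<psi>"
proof
  assume max: "bounded_countably_maxitive M \<psi>"
  show "st_monotone M \<psi> \<and> countably_directed_sublevels M \<psi>"
  proof
    show "st_monotone M \<psi>"
      unfolding st_monotone_def
    proof (intro ballI impI)
      fix \<xi> \<eta> assume *: "\<xi> \<in> rv_classes M" "\<eta> \<in> rv_classes M" "st_le M \<xi> \<eta>"
      then have up: "st_upper M {\<xi>, \<eta>} \<eta>"
        by (auto simp: st_upper_def st_le_def)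
      have "st_upper M {\<xi>, \<eta>} (st_Sup M {\<xi>, \<eta>}) \<and>
          (\<forall>\<zeta>. st_upper M {\<xi>, \<eta>} \<zeta> \<longrightarrow> st_le M (st_Sup M {\<xi>, \<eta>}) \<zeta>)"
        using * up by (intro st_Sup_least_upper[OF assms(1)]) auto
      then have "st_Sup M {\<xi>, \<eta>} = \<eta>"
        using up by (intro quantile_inj antisym) (auto simp: st_upper_def st_le_def)
      moreover have "(SUP y\<in>{\<xi>, \<eta>}. \<psi> y) = \<psi> (st_Sup M {\<xi>, \<eta>})"
        using max * up unfolding bounded_countably_maxitive_def
        by (metis bot.extremum countable_empty countable_insert insert_not_empty insert_subset)
      ultimately have "(SUP y\<in>{\<xi>, \<eta>}. \<psi> y) = \<psi> \<eta>"
        by simp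
      then show "\<psi> \<xi> \<le> \<psi> \<eta>"
        by (metis SUP_upper insertI1)
    qed
    show "countably_directed_sublevels M \<psi>"
      unfolding countably_directed_sublevels_def
    proof (intro allI impI)
      fix s Y assume Y: "Y \<subseteq> sublevel M \<psi> s \<and> Y \<noteq> {} \<and> countable Y"
      then have sub: "Y \<subseteq> rv_classes M" "Y \<noteq> {}" "countable Y"
        by (auto simp: sublevel_def)
      have le: "(SUP y\<in>Y. \<psi> y) \<le> ereal s"
        using Y by (intro SUP_least) (auto simp: sublevel_def)
      then have "(SUP y\<in>Y. \<psi> y) \<noteq> \<infinity>"
        by auto
      then obtain \<eta> where \<eta>: "st_upper M Y \<eta>"
        using max sub unfolding bounded_countably_maxitive_def by blast
      then have "(SUP y\<in>Y. \<psi> y) = \<psi> (st_Sup M Y)"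
        using max sub unfolding bounded_countably_maxitive_def by blast
      moreover have "st_upper M Y (st_Sup M Y)"
        using st_Sup_least_upper[OF assms(1) sub(1,2) \<eta>] by blast
      ultimately show "\<exists>y'\<in>sublevel M \<psi> s. \<forall>y\<in>Y. st_le M y y'"
        using le by (auto simp: st_upper_def sublevel_def)
    qed
  qed
next
  assume "st_monotone M \<psi> \<and> countably_directed_sublevels M \<psi>"
  then have mono: "st_monotone M \<psi>" and dir: "countably_directed_sublevels M \<psi>"
    by auto
  show "bounded_countably_maxitive M \<psi>"
    unfolding bounded_countably_maxitive_def
  proof (intro allI impI)
    fix Y assume Y: "Y \<subseteq> rv_classes M \<and> Y \<noteq> {} \<and> countable Y"
    let ?S = "SUP y\<in>Y. \<psi> y"
    \<comment> \<open>Serves both cases: an unbounded \<open>Y\<close> must have infinite supremum,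
      and for a bounded one the least upper bound lies below this \<eta>. That \<psi> avoids
      -\<infinity> makes the level a real number.\<close>
    have upper: "\<exists>\<eta>. st_upper M Y \<eta> \<and> \<psi> \<eta> \<le> ?S" if fin: "?S \<noteq> \<infinity>"
    proof -
      obtain y where y: "y \<in> Y" using Y by auto
      then have "- \<infinity> < \<psi> y" "\<psi> y \<le> ?S"
        using Y assms(2) by (auto intro: SUP_upper)
      then obtain s where s: "?S = ereal s"
        using fin by (cases ?S) auto
      have "Y \<subseteq> sublevel M \<psi> s"
        using Y unfolding sublevel_def s[symmetric] by (auto intro: SUP_upper)
      then obtain \<eta> where "\<eta> \<in> sublevel M \<psi> s" "\<forall>y\<in>Y. st_le M y \<eta>"
        using Y dir unfolding countably_directed_sublevels_def by blast
      then show ?thesis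
        using s by (auto simp: sublevel_def st_upper_def)
    qed
    show "((\<exists>\<eta>. st_upper M Y \<eta>) \<longrightarrow> ?S = \<psi> (st_Sup M Y)) \<and>
        (\<not> (\<exists>\<eta>. st_upper M Y \<eta>) \<longrightarrow> ?S = \<infinity>)"
    proof (intro conjI impI)
      assume "\<exists>\<eta>. st_upper M Y \<eta>"
      then have lub: "st_upper M Y (st_Sup M Y)"
          "\<And>\<eta>. st_upper M Y \<eta> \<Longrightarrow> st_le M (st_Sup M Y) \<eta>"
        using st_Sup_least_upper[OF assms(1)] Y by blast+
      show "?S = \<psi> (st_Sup M Y)"
      proof (rule antisym)
        show "?S \<le> \<psi> (st_Sup M Y)"
          using mono lub(1) Y by (intro SUP_least) (auto simp: st_monotone_def st_upper_def)
        show "\<psi> (st_Sup M Y) \<le> ?S"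
        proof (cases "?S = \<infinity>")
          case False
          then obtain \<eta> where \<eta>: "st_upper M Y \<eta>" "\<psi> \<eta> \<le> ?S"
            using upper by blast
          then have "\<psi> (st_Sup M Y) \<le> \<psi> \<eta>"
            using mono lub by (auto simp: st_monotone_def st_upper_def)
          then show ?thesis
            using \<eta>(2) by (rule order_trans)
        qed simp
      qed
    next
      assume "\<not> (\<exists>\<eta>. st_upper M Y \<eta>)"
      then show "?S = \<infinity>"
        using upper by meson
    qed
  qed
qed

section \<open>Level functions and their generalised inverses\<close>

lemma alpha_min_mono:
  assumes "s \<le> t"
  shows "alpha_min M \<psi> s u \<le> alpha_min M \<psi> t u"
proof -
  have "x \<le> ereal t" if "x \<le> ereal s" for x
    using that assms by (meson ereal_less_eq(3) order_trans)
  then have "sublevel M \<psi> s \<subseteq> sublevel M \<psi> t"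
    by (auto simp: sublevel_def)
  then show ?thesis
    unfolding alpha_min_def by (intro SUP_subset_mono) simp_all
qed

text \<open>\<open>G_min\<close> is the generalised inverse of \<open>alpha_min_plus\<close> in the
  level. Equivalence at the infimum itself rests on right-continuity in \<open>s\<close>, which the
  infimum over \<open>t > s\<close> provides.\<close>

lemma G_min_le_iff: "G_min M \<psi> t u \<le> ereal s \<longleftrightarrow> ereal t \<le> alpha_min_plus M \<psi> s u"
proof
  assume le: "G_min M \<psi> t u \<le> ereal s"
  show "ereal t \<le> alpha_min_plus M \<psi> s u"
    unfolding alpha_min_plus_def
  proof (rule INF_greatest)
    fix r assume "r \<in> {s<..}"
    then have "G_min M \<psi> t u < ereal r"
      using le by (auto intro: le_less_trans)
    \<comment> \<open>Some level \<open>s' < r\<close> already qualifies, and \<open>r\<close> is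
      among the levels over which \<open>alpha_min_plus\<close> at \<open>s'\<close> takes its
      infimum.\<close>
    then obtain s' where s': "ereal t \<le> alpha_min_plus M \<psi> s' u" "s' < r"
      by (auto simp: G_min_def Inf_less_iff)
    then have "alpha_min_plus M \<psi> s' u \<le> alpha_min M \<psi> r u"
      unfolding alpha_min_plus_def by (intro INF_lower) auto
    with s'(1) show "ereal t \<le> alpha_min M \<psi> r u"
      by (rule order_trans)
  qed
next
  assume "ereal t \<le> alpha_min_plus M \<psi> s u"
  then show "G_min M \<psi> t u \<le> ereal s"
    unfolding G_min_def by (intro Inf_lower) auto
qed

lemma le_alpha_min_plus_iff:
  "ereal t \<le> alpha_min_plus M \<psi> s u \<longleftrightarrow> (\<forall>r>s. ereal t \<le> alpha_min M \<psi> r u)"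
  by (auto simp: alpha_min_plus_def le_INF_iff)

text \<open>Quantiles are real, so subtracting \<alpha> never produces \<infinity> - \<infinity>;
  where \<alpha> is -\<infinity> the difference is \<infinity> and both sides fail.\<close>

lemma mem_admissible_levels_iff:
  "ereal s \<in> admissible_levels M \<alpha> \<xi> \<longleftrightarrow> (\<forall>u\<in>{0<..<1}. ereal (quantile M \<xi> u) \<le> \<alpha> s u)"
proof -
  have "ereal q - a \<le> 0 \<longleftrightarrow> ereal q \<le> a" for q a
    by (cases a) auto
  then show ?thesis
    by (auto simp: admissible_levels_def SUP_le_iff)
qed

lemma ereal_le_iff_all_greater: "x \<le> ereal s \<longleftrightarrow> (\<forall>r>s. x \<le> ereal r)"
proof (intro iffI allI impI)
  fix r assume "x \<le> ereal s" "s < r"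
  then show "x \<le> ereal r"
    by (meson ereal_less_eq(3) less_imp_le order_trans)
next
  assume *: "\<forall>r>s. x \<le> ereal r"
  show "x \<le> ereal s"
  proof (rule ereal_le_epsilon2)
    fix e :: real assume "0 < e"
    then show "x \<le> ereal s + ereal e"
      using *[rule_format, of "s + e"] by simp
  qed
qed

section \<open>Equivalence of maxitivity, directedness and the two quantile representations\<close>

theorem corollary5p2:
  fixes M :: "'a measure" and \<psi> :: "('a \<Rightarrow> real) set \<Rightarrow> ereal"
  assumes "prob_space M" and "atomless M"
    and "\<forall>\<xi>\<in>rv_classes M. \<psi> \<xi> > -\<infinity>"
  shows "(bounded_countably_maxitive M \<psi> \<longleftrightarrow>
            st_monotone M \<psi> \<and> countably_directed_sublevels M \<psi>)
       \<and> (bounded_countably_maxitive M \<psi> \<longleftrightarrow>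
            (\<exists>\<alpha> :: real \<Rightarrow> real \<Rightarrow> ereal.
               (\<forall>s. \<forall>u\<in>{0<..<1}. \<alpha> s u < \<infinity>)
             \<and> (\<forall>u\<in>{0<..<1}. mono (\<lambda>s. \<alpha> s u))
             \<and> (\<forall>\<xi>\<in>rv_classes M. \<psi> \<xi> = Inf (admissible_levels M \<alpha> \<xi>))
             \<and> (\<forall>\<xi>\<in>rv_classes M. \<psi> \<xi> < \<infinity> \<longrightarrow>
                   Inf (admissible_levels M \<alpha> \<xi>) \<in> admissible_levels M \<alpha> \<xi>)))
       \<and> (bounded_countably_maxitive M \<psi> \<longleftrightarrow>
            (\<forall>s. sublevel M \<psi> s \<noteq> {} \<longrightarrow>
               (\<forall>u\<in>{0<..<1}. \<bar>alpha_min M \<psi> s u\<bar> \<noteq> \<infinity>))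
          \<and> (\<forall>\<xi>\<in>rv_classes M. \<psi> \<xi> = (SUP u\<in>{0<..<1}. G_min M \<psi> (quantile M \<xi> u) u)))"
    (is "(_ \<longleftrightarrow> ?ii) \<and> (_ \<longleftrightarrow> ?iii) \<and> (_ \<longleftrightarrow> ?iv)")
proof -
  interpret prob_space M by fact
  have i_ii: "bounded_countably_maxitive M \<psi> \<longleftrightarrow> ?ii"
    using assms(2,3) by (rule bounded_countably_maxitive_iff)
  have G_le_iff: "(SUP u\<in>{0<..<1}. G_min M \<psi> (quantile M \<xi> u) u) \<le> ereal s \<longleftrightarrow>
      (\<forall>u\<in>{0<..<1}. ereal (quantile M \<xi> u) \<le> alpha_min_plus M \<psi> s u)" for \<xi> s
    by (simp add: SUP_le_iff G_min_le_iff)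
  have ii_iii: ?iii if ii: ?ii
  proof (intro exI[of _ "alpha_min M \<psi>"] conjI ballI allI impI)
    fix u :: real assume u: "u \<in> {0<..<1}"
    show "alpha_min M \<psi> s u < \<infinity>" for s
    proof (cases "sublevel M \<psi> s = {}")
      case True
      then show ?thesis by (simp add: alpha_min_def bot_ereal_def)
    next
      case False
      then obtain y where "alpha_min M \<psi> s u = ereal (quantile M y u)"
        using sublevel_greatest[OF conjunct2[OF ii]] u by metis
      then show ?thesis
        by simp
    qed
    show "mono (\<lambda>s. alpha_min M \<psi> s u)"
      by (intro monoI alpha_min_mono)
  next
    fix \<xi> assume \<xi>: "\<xi> \<in> rv_classes M"
    \<comment> \<open>The admissible levels of \<xi> are exactly the real numbers at or above
      \<open>\<psi> \<xi>\<close>, so their infimum is \<open>\<psi> \<xi>\<close> and is a minimum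
      when finite.\<close>
    have le_iff: "\<psi> \<xi> \<le> ereal s \<longleftrightarrow> ereal s \<in> admissible_levels M (alpha_min M \<psi>) \<xi>" for s
      using ii \<xi> by (simp add: le_iff_quantile_le_alpha_min mem_admissible_levels_iff)
    show eq: "\<psi> \<xi> = Inf (admissible_levels M (alpha_min M \<psi>) \<xi>)"
    proof (rule antisym)
      show "\<psi> \<xi> \<le> Inf (admissible_levels M (alpha_min M \<psi>) \<xi>)"
      proof (rule Inf_greatest)
        fix x assume "x \<in> admissible_levels M (alpha_min M \<psi>) \<xi>"
        moreover from this obtain s where "x = ereal s"
          by (auto simp: admissible_levels_def)
        ultimately show "\<psi> \<xi> \<le> x"
          using le_iff by simp
      qed
      show "Inf (admissible_levels M (alpha_min M \<psi>) \<xi>) \<le> \<psi> \<xi>"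
      proof (rule ereal_le_real)
        fix s assume "\<psi> \<xi> \<le> ereal s"
        then show "Inf (admissible_levels M (alpha_min M \<psi>) \<xi>) \<le> ereal s"
          using le_iff by (intro Inf_lower) simp
      qed
    qed
    assume "\<psi> \<xi> < \<infinity>"
    then obtain s where "\<psi> \<xi> = ereal s"
      using assms(3) \<xi> by (cases "\<psi> \<xi>") auto
    then show "Inf (admissible_levels M (alpha_min M \<psi>) \<xi>) \<in> admissible_levels M (alpha_min M \<psi>) \<xi>"
      using le_iff[of s] eq by simp
  qed
  have iii_ii: ?ii if iii: ?iii
  proof -
    obtain \<alpha> :: "real \<Rightarrow> real \<Rightarrow> ereal" where \<alpha>:
        "\<And>s u. u \<in> {0<..<1} \<Longrightarrow> \<alpha> s u < \<infinity>"
        "\<And>u. u \<in> {0<..<1} \<Longrightarrow> mono (\<lambda>s. \<alpha> s u)"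
        "\<And>\<xi>. \<xi> \<in> rv_classes M \<Longrightarrow> \<psi> \<xi> = Inf (admissible_levels M \<alpha> \<xi>)"
        "\<And>\<xi>. \<xi> \<in> rv_classes M \<Longrightarrow> \<psi> \<xi> < \<infinity> \<Longrightarrow>
          Inf (admissible_levels M \<alpha> \<xi>) \<in> admissible_levels M \<alpha> \<xi>"
      using iii by blast
    \<comment> \<open>Attainment makes \<open>s\<^sub>0 = \<psi> \<xi>\<close> an admissible level;
      monotonicity of \<alpha> in the level carries the bound on to every
      \<open>s \<ge> s\<^sub>0\<close>.\<close>
    have le_iff: "\<psi> \<xi> \<le> ereal s \<longleftrightarrow> (\<forall>u\<in>{0<..<1}. ereal (quantile M \<xi> u) \<le> \<alpha> s u)"
      if \<xi>: "\<xi> \<in> rv_classes M" for \<xi> s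
    proof
      assume le: "\<psi> \<xi> \<le> ereal s"
      then have "\<psi> \<xi> < \<infinity>"
        by auto
      then obtain s\<^sub>0 where s\<^sub>0: "\<psi> \<xi> = ereal s\<^sub>0" "ereal s\<^sub>0 \<in> admissible_levels M \<alpha> \<xi>"
        using \<alpha>(4)[OF \<xi>] unfolding \<alpha>(3)[OF \<xi>, symmetric] by (auto simp: admissible_levels_def)
      show "\<forall>u\<in>{0<..<1}. ereal (quantile M \<xi> u) \<le> \<alpha> s u"
      proof
        fix u :: real assume u: "u \<in> {0<..<1}"
        then have "ereal (quantile M \<xi> u) \<le> \<alpha> s\<^sub>0 u"
          using s\<^sub>0(2) by (simp add: mem_admissible_levels_iff)
        also have "\<dots> \<le> \<alpha> s u"
          using monoD[OF \<alpha>(2)[OF u], of s\<^sub>0 s] le s\<^sub>0(1) by simp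
        finally show "ereal (quantile M \<xi> u) \<le> \<alpha> s u" .
      qed
    next
      assume "\<forall>u\<in>{0<..<1}. ereal (quantile M \<xi> u) \<le> \<alpha> s u"
      then show "\<psi> \<xi> \<le> ereal s"
        unfolding \<alpha>(3)[OF \<xi>] by (intro Inf_lower) (simp add: mem_admissible_levels_iff)
    qed
    \<comment> \<open>Any representing \<alpha> dominates \<open>alpha_min\<close>, which therefore
      stays below \<infinity>.\<close>
    have "alpha_min M \<psi> s u < \<infinity>" if "u \<in> {0<..<1}" for s u
    proof -
      have "alpha_min M \<psi> s u \<le> \<alpha> s u"
        unfolding alpha_min_def using le_iff that by (intro SUP_least) (auto simp: sublevel_def)
      then show ?thesis
        using \<alpha>(1)[OF that] by (rule le_less_trans)
    qed
    then show ?thesis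
      using le_iff by (intro monotone_directed_if_sublevels_below[OF assms(2)])
  qed
  have ii_iv: ?iv if ii: ?ii
  proof (intro conjI ballI allI impI)
    fix s and u :: real assume *: "sublevel M \<psi> s \<noteq> {}" "u \<in> {0<..<1}"
    obtain y where "alpha_min M \<psi> s u = ereal (quantile M y u)"
      using sublevel_greatest[OF conjunct2[OF ii] *(1)] *(2) by metis
    then show "\<bar>alpha_min M \<psi> s u\<bar> \<noteq> \<infinity>"
      by simp
  next
    fix \<xi> assume \<xi>: "\<xi> \<in> rv_classes M"
    \<comment> \<open>Passing from \<open>alpha_min\<close> to \<open>alpha_min_plus\<close> costs
      nothing: both sides become statements about all real levels \<open>r > s\<close>.\<close>
    have "(SUP u\<in>{0<..<1}. G_min M \<psi> (quantile M \<xi> u) u) \<le> ereal s \<longleftrightarrow> \<psi> \<xi> \<le> ereal s" for s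
    proof -
      have "(SUP u\<in>{0<..<1}. G_min M \<psi> (quantile M \<xi> u) u) \<le> ereal s \<longleftrightarrow>
          (\<forall>r>s. \<forall>u\<in>{0<..<1}. ereal (quantile M \<xi> u) \<le> alpha_min M \<psi> r u)"
        unfolding G_le_iff le_alpha_min_plus_iff by blast
      also have "\<dots> \<longleftrightarrow> (\<forall>r>s. \<psi> \<xi> \<le> ereal r)"
        using ii \<xi> by (simp add: le_iff_quantile_le_alpha_min)
      finally show ?thesis
        by (simp flip: ereal_le_iff_all_greater)
    qed
    \<comment> \<open>Extended reals with the same real upper bounds are equal.\<close>
    then show "\<psi> \<xi> = (SUP u\<in>{0<..<1}. G_min M \<psi> (quantile M \<xi> u) u)"
      using ereal_le_real by (metis (no_types, lifting) antisym)
  qed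
  have iv_ii: ?ii if iv: ?iv
  proof (rule monotone_directed_if_sublevels_below[OF assms(2), where \<beta> = "alpha_min_plus M \<psi>"])
    fix \<xi> s assume "\<xi> \<in> rv_classes M"
    with conjunct2[OF iv] have "\<psi> \<xi> = (SUP u\<in>{0<..<1}. G_min M \<psi> (quantile M \<xi> u) u)"
      by (rule bspec)
    then show "\<psi> \<xi> \<le> ereal s \<longleftrightarrow>
        (\<forall>u\<in>{0<..<1}. ereal (quantile M \<xi> u) \<le> alpha_min_plus M \<psi> s u)"
      by (simp only: G_le_iff)
  next
    fix s and u :: real assume *: "sublevel M \<psi> s \<noteq> {}" "u \<in> {0<..<1}"
    have "\<bar>alpha_min M \<psi> s u\<bar> \<noteq> \<infinity>"
      by (rule conjunct1[OF iv, THEN spec, THEN mp, THEN bspec, OF *])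
    then show "alpha_min M \<psi> s u < \<infinity>"
      by (cases "alpha_min M \<psi> s u") simp_all
  qed
  have "?ii \<longleftrightarrow> ?iii" "?ii \<longleftrightarrow> ?iv"
    by (rule iffI[OF ii_iii iii_ii], assumption+) (rule iffI[OF ii_iv iv_ii], assumption+)
  then show ?thesis
    unfolding i_ii by (intro conjI refl)
qed

end
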